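(* For each $\delta>0$ let $g^\delta\in H_2$ with $\|g^\delta-g\|\le\delta$. Let $\Gamma:(0,\infty)\times H_2\to\mathbb{N}$ be Morozov's discrepancy principle with parameter $\rho>1$ and assume that there is $N\in\mathbb{N}$ with $$\limsup_{\delta\to0^+}\Gamma(\delta,g^\delta)=N .$$ Then the following assertions are true: (i) The set $\{p_N^\delta\}_{\delta>0}$ is bounded and each of its weak cluster points is a minimizer of $G(\cdot,g)$. (ii) The set $\{u_N^\delta\}_{\delta>0}$ is bounded and each of its weak cluster points is a $J$-minimizing solution of $Ku=g$. (iii) All $J$-minimizing solutions $u^\dagger$ of $Ku=g$ satisfy the source condition $K^*p^\dagger\in\partial J(u^\dagger)$ with a source element $p^\dagger\in H_2$. (iv) One has $$\|Ku_N^\delta-g\|<(\rho+1)\delta\qquad\text{and}\qquad D_J^{\mathrm{sym}}(u_N^\delta,u^\dagger)=\mathcal{O}(\delta),$$ where $u^\dagger$ is a $J$-minimizing solution of $Ku=g$ (with source element $p^\dagger$ as in (iii)).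
   Context: $H_1,H_2$ are separable Hilbert spaces, $K:H_1\to H_2$ is linear and bounded with adjoint $K^*$, and $J:H_1\to\mathbb{R}\cup\{\infty\}$ is convex, lower semicontinuous and proper with domain $D(J)=\{u\in H_1: J(u)<\infty\}$. It is assumed that for every $c\in\mathbb{R}$ every sequence in $\{u\in H_1:\|Ku\|^2+J(u)\le c\}$ has a weakly convergent subsequence in $H_1$. The element $g\in H_2$ is attainable, i.e. $Ku=g$ for some $u\in D(J)$. A $J$-minimizing solution of $Ku=g$ is a minimizer of $J(u)$ subject to $Ku=g$. The subdifferential $\partial J(u)$ is the set of all $\xi\in H_1$ with $J(v)-J(u)-\langle\xi,v-u\rangle\ge0$ for all $v\in H_1$. Augmented Lagrangian method: $\{\tau_n\}_{n\ge1}$ is a fixed sequence of positive numbers, $t_n:=\sum_{k=1}^n\tau_k$, with $t_n\to+\infty$ and $\sup_k\tau_k<\infty$. Given data $g^\delta$ and a starting element $p_0^\delta\in H_2$, for $n=1,2,\dots$ $$u_n^\delta\in\operatorname{argmin}_{u\in H_1}\Big(\tfrac{\tau_n}{2}\|Ku-g^\delta\|^2+J(u)-\langle p_{n-1}^\delta,Ku-g^\delta\rangle\Big),\qquad p_n^\delta=p_{n-1}^\delta+\tau_n(g^\delta-Ku_n^\delta).$$ One has $K^*p_n^\delta\in\partial J(u_n^\delta)$. Morozov's discrepancy principle with $\rho>1$ is the stopping rule $\Gamma(\delta,g^\delta):=\min\{n\in\mathbb{N}:\ \|Ku_n^\delta-g^\delta\|<\rho\delta\}$ (this minimum exists). $J^*(v)=\sup_{u\in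 H_1}(\langle v,u\rangle-J(u))$ is the Legendre-Fenchel conjugate of $J$, and $G(p,g)=J^*(K^*p)-\langle p,g\rangle$ for $p\in H_2$. The symmetric Bregman distance, for $\eta\in\partial J(v)$ and $\xi\in\partial J(u)$, is $D_J^{\mathrm{sym}}(v,u)=\langle\eta-\xi,v-u\rangle$; in $D_J^{\mathrm{sym}}(u_N^\delta,u^\dagger)$ the subgradients used are $K^*p_N^\delta\in\partial J(u_N^\delta)$ and $K^*p^\dagger\in\partial J(u^\dagger)$.
   Formalization: Starting elements p_0^δ are assumed bounded for 0<δ≤δ_0 (δ_0>0 arbitrary); boundedness of p_N^δ and u_N^δ is claimed on that range, since it fails over all δ>0. Weak cluster points are taken as δ→0+, and the bound (ρ+1)δ is for small δ. *)

theory Defs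
  imports "HOL-Analysis.Analysis" "HOL-Library.Landau_Symbols" "HOL-Library.Extended_Nat"
begin

text \<open>Real Hilbert spaces are types of sort \<open>{real_inner, complete_space}\<close>.
  Functionals with values in the reals extended by plus infinity are \<open>ereal\<close>-valued functions;
  the value minus infinity is excluded by properness.\<close>

definition proper :: "('a \<Rightarrow> ereal) \<Rightarrow> bool" where
  "proper J \<longleftrightarrow> (\<forall>u. J u \<noteq> -\<infinity>) \<and> (\<exists>u. J u < \<infinity>)"

text \<open>Note \<open>0 * \<infinity> = 0\<close> in \<open>ereal\<close>, so the cases \<open>t = 0\<close> and \<open>t = 1\<close> are harmless.\<close>

definition convex_ereal :: "('a::real_vector \<Rightarrow> ereal) \<Rightarrow> bool" where
  "convex_ereal J \<longleftrightarrow>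
    (\<forall>u v. \<forall>t\<in>{0..1::real}.
      J ((1 - t) *\<^sub>R u + t *\<^sub>R v) \<le> ereal (1 - t) * J u + ereal t * J v)"

definition lower_semicont :: "('a::topological_space \<Rightarrow> ereal) \<Rightarrow> bool" where
  "lower_semicont J \<longleftrightarrow> (\<forall>u. J u \<le> Liminf (at u) J)"

definition weakly_tendsto :: "('i \<Rightarrow> 'a::real_inner) \<Rightarrow> 'a \<Rightarrow> 'i filter \<Rightarrow> bool" where
  "weakly_tendsto x l F \<longleftrightarrow> (\<forall>v. ((\<lambda>i. x i \<bullet> v) \<longlongrightarrow> l \<bullet> v) F)"

text \<open>Weak (sequential) cluster points of a family indexed by the noise level,
  as the noise level tends to zero from the right.\<close>

definition weak_cluster_point :: "(real \<Rightarrow> 'a::real_inner) \<Rightarrow> 'a \<Rightarrow> bool" where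
  "weak_cluster_point x l \<longleftrightarrow>
    (\<exists>d. filterlim d (at_right 0) sequentially \<and> weakly_tendsto (\<lambda>k. x (d k)) l sequentially)"

definition weakly_precompact_sublevels ::
    "('a::real_inner \<Rightarrow> 'b::real_inner) \<Rightarrow> ('a \<Rightarrow> ereal) \<Rightarrow> bool" where
  "weakly_precompact_sublevels K J \<longleftrightarrow>
    (\<forall>c::real. \<forall>x::nat \<Rightarrow> 'a.
      range x \<subseteq> {u. ereal ((norm (K u))\<^sup>2) + J u \<le> ereal c} \<longrightarrow>
      (\<exists>l r. strict_mono r \<and> weakly_tendsto (x \<circ> r) l sequentially))"

text \<open>If \<open>J u = \<infinity>\<close> and \<open>J\<close> is proper, then taking \<open>v\<close> with \<open>J v < \<infinity>\<close>
  makes the left-hand side \<open>-\<infinity>\<close>, so the subdifferential is empty there.\<close>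

definition subdifferential :: "('a::real_inner \<Rightarrow> ereal) \<Rightarrow> 'a \<Rightarrow> 'a set" where
  "subdifferential J u = {\<xi>. \<forall>v. J v - J u - ereal (\<xi> \<bullet> (v - u)) \<ge> 0}"

definition J_minimizing_solution ::
    "('a \<Rightarrow> 'b) \<Rightarrow> ('a \<Rightarrow> ereal) \<Rightarrow> 'b \<Rightarrow> 'a \<Rightarrow> bool" where
  "J_minimizing_solution K J g u \<longleftrightarrow> is_arg_min J (\<lambda>v. K v = g) u"

definition conjugate :: "('a::real_inner \<Rightarrow> ereal) \<Rightarrow> 'a \<Rightarrow> ereal" where
  "conjugate J v = (SUP u. ereal (v \<bullet> u) - J u)"

definition dual_functional ::
    "('a::real_inner \<Rightarrow> 'b::real_inner) \<Rightarrow> ('a \<Rightarrow> ereal) \<Rightarrow> 'b \<Rightarrow> 'b \<Rightarrow> ereal" where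
  "dual_functional K J p g = conjugate J (adjoint K p) - ereal (p \<bullet> g)"

text \<open>The symmetric Bregman distance of \<open>v\<close> and \<open>u\<close> with respect to the chosen
  subgradients \<open>\<eta>\<close> at \<open>v\<close> and \<open>\<xi>\<close> at \<open>u\<close>; the functional enters through these only.\<close>

definition bregman_sym :: "'a::real_inner \<Rightarrow> 'a \<Rightarrow> 'a \<Rightarrow> 'a \<Rightarrow> real" where
  "bregman_sym \<eta> \<xi> v u = (\<eta> - \<xi>) \<bullet> (v - u)"

text \<open>\<open>(u, p)\<close> is a run of the augmented Lagrangian method for data \<open>y\<close> started at \<open>q\<close>.
  Minimizers need not be unique, hence a relation. The value \<open>u 0\<close> is irrelevant.\<close>

definition augmented_lagrangian_run ::
    "('a::real_inner \<Rightarrow> 'b::real_inner) \<Rightarrow> ('a \<Rightarrow> ereal) \<Rightarrow> (nat \<Rightarrow> real) \<Rightarrow> 'b \<Rightarrow> 'b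
      \<Rightarrow> (nat \<Rightarrow> 'a) \<Rightarrow> (nat \<Rightarrow> 'b) \<Rightarrow> bool" where
  "augmented_lagrangian_run K J \<tau> y q u p \<longleftrightarrow>
    p 0 = q \<and>
    (\<forall>n\<ge>1.
      is_arg_min
        (\<lambda>v. ereal (\<tau> n / 2 * (norm (K v - y))\<^sup>2) + J v - ereal (p (n - 1) \<bullet> (K v - y)))
        (\<lambda>_. True) (u n) \<and>
      p n = p (n - 1) + \<tau> n *\<^sub>R (y - K (u n)))"

text \<open>The iterates \<open>u n\<close> start at \<open>n = 1\<close>.\<close>

definition morozov ::
    "('a \<Rightarrow> 'b::real_normed_vector) \<Rightarrow> real \<Rightarrow> (nat \<Rightarrow> 'a) \<Rightarrow> real \<Rightarrow> 'b \<Rightarrow> nat" where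
  "morozov K \<rho> u \<delta> y = (LEAST n. 1 \<le> n \<and> norm (K (u n) - y) < \<rho> * \<delta>)"

end

theory Submission
  imports Defs
begin

text \<open>
  The dual iterates are the iterates of a proximal point method for the convex functional
  \<open>G(\<cdot>, g\<^sup>\<delta>)\<close>, so two runs with different data and starting elements stay at distance at most
  \<open>\<parallel>q - q'\<parallel> + t\<^sub>n \<parallel>y - y'\<parallel>\<close>. Hence \<open>p\<^sub>N\<^sup>\<delta>\<close> is bounded, and so is
  \<open>K u\<^sub>N\<^sup>\<delta> = g\<^sup>\<delta> - (p\<^sub>N\<^sup>\<delta> - p\<^sub>N\<^sub>-\<^sub>1\<^sup>\<delta>) / \<tau>\<^sub>N\<close>. The residuals decrease along a run and the
  stopping index is eventually at most \<open>N\<close>, so \<open>\<parallel>K u\<^sub>N\<^sup>\<delta> - g\<^sup>\<delta>\<parallel> < \<rho>\<delta>\<close> for small \<open>\<delta>\<close>; with the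
  boundedness of the dual variables the subgradient inequality for \<open>K\<^sup>* p\<^sub>N\<^sup>\<delta>\<close> passes to the limit.

  For the source condition no weak limit of \<open>p\<^sub>N\<^sup>\<delta>\<close> is extracted: for each \<open>\<epsilon> > 0\<close> some \<open>p\<^sub>N\<^sup>\<delta>\<close>
  lies in the bounded closed convex set of approximate source elements
  \<open>{p. \<forall>v. J u\<^sup>\<dagger> + \<langle>p, K v - g\<rangle> - \<epsilon> \<le> J v}\<close>, and nested sets of this kind in a Hilbert space
  have a common point, the limit of almost norm-minimal elements.
\<close>

section \<open>Hilbert space geometry: nested convex sets, projection, Riesz representation, weak
  convergence\<close>

text \<open>The distances \<open>r n\<close> from the origin increase with \<open>n\<close> and stay
  below \<open>R\<close>, hence converge. Midpoints of late elements stay in \<open>C M\<close> by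
  convexity, so the parallelogram identity forces the almost norm-minimal \<open>x n\<close> to be
  Cauchy.\<close>

lemma nested_closed_convex_Inter_nonempty:
  fixes C :: "nat \<Rightarrow> 'a::{real_inner, complete_space} set"
  assumes closed: "\<And>n. closed (C n)" and convex: "\<And>n. convex (C n)"
    and dec: "\<And>m n. m \<le> n \<Longrightarrow> C n \<subseteq> C m" and ne: "\<And>n. C n \<noteq> {}"
    and bnd: "\<And>n x. x \<in> C n \<Longrightarrow> norm x \<le> R"
  obtains x where "\<And>n. x \<in> C n"
proof -
  define r where "r n = Inf (norm ` C n)" for n
  have bdd: "bdd_below (norm ` C n)" for n by (auto intro: bdd_belowI[of _ 0])
  have r_le: "r n \<le> norm x" if "x \<in> C n" for n x
    unfolding r_def using that bdd by (intro cInf_lower) auto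
  have r0: "0 \<le> r n" for n
    unfolding r_def using ne by (intro cInf_greatest) auto
  have rR: "r n \<le> R" for n
    using ne[of n] r_le[of _ n] bnd[of _ n] by (meson ex_in_conv order_trans)
  have "incseq r"
    unfolding r_def using ne dec bdd by (intro incseq_SucI cInf_superset_mono image_mono) auto
  then obtain L where L: "r \<longlonglongrightarrow> L" using rR incseq_convergent[of r R] by blast
  have "\<exists>y\<in>C n. norm y < r n + inverse (real (Suc n))" for n
  proof -
    have "Inf (norm ` C n) < r n + inverse (real (Suc n))" by (simp add: r_def)
    from cInf_lessD[OF _ this] ne[of n] show ?thesis by auto
  qed
  then obtain x where xC: "x n \<in> C n" and xr: "norm (x n) < r n + inverse (real (Suc n))" for n
    by metis
  have "(\<lambda>n. r n + inverse (real (Suc n))) \<longlonglongrightarrow> L + 0"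
    by (intro tendsto_add L LIMSEQ_inverse_real_of_nat)
  then have s: "(\<lambda>n. (r n + inverse (real (Suc n)))\<^sup>2) \<longlonglongrightarrow> L\<^sup>2"
    by (auto intro: tendsto_power)
  have r2: "(\<lambda>n. (r n)\<^sup>2) \<longlonglongrightarrow> L\<^sup>2" by (intro tendsto_power L)
  have "Cauchy x"
  proof (rule metric_CauchyI)
    fix e :: real assume e: "e > 0"
    \<comment> \<open>In the parallelogram identity this error enters with total weight 2 + 2 + 4 =
      8, which yields exactly \<open>e\<^sup>2\<close>.\<close>
    from e have "e\<^sup>2 / 8 > 0" by simp
    from order_tendstoD(2)[OF s, of "L\<^sup>2 + e\<^sup>2 / 8"] order_tendstoD(1)[OF r2, of "L\<^sup>2 - e\<^sup>2 / 8"] this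
    have "\<forall>\<^sub>F n in sequentially. (r n + inverse (real (Suc n)))\<^sup>2 < L\<^sup>2 + e\<^sup>2 / 8 \<and> L\<^sup>2 - e\<^sup>2 / 8 < (r n)\<^sup>2"
      by (intro eventually_conj) auto
    then obtain M where M: "\<And>n. n \<ge> M \<Longrightarrow> (r n + inverse (real (Suc n)))\<^sup>2 < L\<^sup>2 + e\<^sup>2 / 8"
      and M': "L\<^sup>2 - e\<^sup>2 / 8 < (r M)\<^sup>2"
      unfolding eventually_sequentially by blast
    have "dist (x m) (x n) < e" if "m \<ge> M" "n \<ge> M" for m n
    proof -
      have xm: "(norm (x k))\<^sup>2 < L\<^sup>2 + e\<^sup>2 / 8" if "k \<ge> M" for k
      proof -
        have "(norm (x k))\<^sup>2 \<le> (r k + inverse (real (Suc k)))\<^sup>2"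
          using xr[of k] by (intro power_mono) auto
        with M[OF that] show ?thesis by simp
      qed
      have "(1/2) *\<^sub>R x m + (1/2) *\<^sub>R x n \<in> C M"
        using xC[of m] xC[of n] dec[OF that(1)] dec[OF that(2)]
        by (intro convexD[OF convex]) auto
      then have "(r M)\<^sup>2 \<le> (norm ((1/2) *\<^sub>R x m + (1/2) *\<^sub>R x n))\<^sup>2"
        using r_le r0 by (intro power_mono) auto
      moreover have "(norm (x m - x n))\<^sup>2 = 2 * (norm (x m))\<^sup>2 + 2 * (norm (x n))\<^sup>2
          - 4 * (norm ((1/2) *\<^sub>R x m + (1/2) *\<^sub>R x n))\<^sup>2"
        by (simp add: power2_norm_eq_inner algebra_simps inner_commute)
      ultimately have "(norm (x m - x n))\<^sup>2 < e\<^sup>2"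
        using xm[OF that(1)] xm[OF that(2)] M' by linarith
      then show ?thesis using e by (simp add: dist_norm power_less_imp_less_base)
    qed
    then show "\<exists>M. \<forall>m\<ge>M. \<forall>n\<ge>M. dist (x m) (x n) < e" by blast
  qed
  then obtain l where l: "x \<longlonglongrightarrow> l" using Cauchy_convergent convergentD by blast
  have "l \<in> C n" for n
  proof (rule closed_sequentially[OF closed])
    show "(\<lambda>k. x (k + n)) \<longlonglongrightarrow> l" using l by (rule LIMSEQ_ignore_initial_segment)
    show "x (k + n) \<in> C n" for k using xC[of "k + n"] dec[of n "k + n"] by auto
  qed
  then show thesis by (rule that)
qed

text \<open>The intersections of \<open>C\<close> with balls about \<open>v\<close>, of radii
  shrinking to the distance \<open>d\<close>, are nested, bounded and convex. A common point attains
  the distance, and minimality over a convex set gives the obtuse-angle inequality.\<close>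

lemma closed_convex_closest_point:
  fixes C :: "'a::{real_inner, complete_space} set"
  assumes "closed C" "convex C" "C \<noteq> {}"
  obtains w where "w \<in> C" "\<And>x. x \<in> C \<Longrightarrow> (v - w) \<bullet> (x - w) \<le> 0"
proof -
  define d where "d = (INF x\<in>C. dist v x)"
  have bdd: "bdd_below (dist v ` C)" by (auto intro: bdd_belowI[of _ 0])
  define A where "A n = C \<inter> cball v (d + inverse (real (Suc n)))" for n
  obtain w where w: "\<And>n. w \<in> A n"
  proof (rule nested_closed_convex_Inter_nonempty[of A "norm v + (d + 1)"])
    show "closed (A n)" "convex (A n)" for n
      unfolding A_def using assms by (auto intro: convex_Int)
    show "A n \<subseteq> A m" if "m \<le> n" for m n
    proof -
      have "inverse (real (Suc n)) \<le> inverse (real (Suc m))" using that by (intro le_imp_inverse_le) auto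
      then show ?thesis unfolding A_def by (intro Int_mono order_refl subset_cball) simp
    qed
    show "A n \<noteq> {}" for n
    proof -
      have "(INF x\<in>C. dist v x) < d + inverse (real (Suc n))" by (simp add: d_def)
      from cInf_lessD[OF _ this] assms(3) show ?thesis unfolding A_def by fastforce
    qed
    show "norm x \<le> norm v + (d + 1)" if "x \<in> A n" for n x
    proof -
      have "norm x \<le> norm v + dist v x" by (metis dist_norm norm_minus_commute norm_triangle_sub)
      moreover have "inverse (real (Suc n)) \<le> 1" by (simp add: inverse_le_1_iff)
      ultimately show ?thesis using that unfolding A_def by auto
    qed
  qed blast
  have wC: "w \<in> C" using w by (auto simp: A_def)
  have "(\<lambda>n. d + inverse (real (Suc n))) \<longlonglongrightarrow> d + 0"
    by (intro tendsto_intros LIMSEQ_inverse_real_of_nat)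
  then have wd: "dist v w \<le> d"
    using w by (intro LIMSEQ_le_const[of _ d]) (auto simp: A_def)
  have min: "dist v w \<le> dist v x" if "x \<in> C" for x
    using wd cINF_lower[OF bdd that] unfolding d_def by linarith
  show thesis
    by (rule that[OF wC]) (use any_closest_point_dot[OF assms(2,1) wC] min in blast)
qed

text \<open>Riesz representation. The point \<open>w\<close> of the hyperplane \<open>f = 1\<close>
  closest to the origin is orthogonal to the kernel of \<open>f\<close>, so \<open>f\<close> is a
  multiple of the inner product with \<open>w\<close>.\<close>

lemma continuous_linear_functional_inner:
  fixes f :: "'a::{real_inner, complete_space} \<Rightarrow> real"
  assumes "bounded_linear f"
  obtains a where "\<And>x. f x = a \<bullet> x"
proof (cases "\<exists>x. f x \<noteq> 0")
  case False
  then show thesis using that[of 0] by simp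
next
  case True
  interpret f: bounded_linear f by fact
  from True obtain x0 where x0: "f x0 \<noteq> 0" by blast
  define C where "C = f -` {1}"
  have "closed C" unfolding C_def
    by (intro closed_vimage continuous_on_closed_vimage closed_singleton f.continuous_on continuous_on_id)
  moreover have "convex C" unfolding C_def
    by (intro convex_linear_vimage f.linear_axioms convex_singleton)
  moreover have "(1 / f x0) *\<^sub>R x0 \<in> C" using x0 by (simp add: C_def f.scaleR)
  ultimately obtain w where wC: "f w = 1" and w: "\<And>x. f x = 1 \<Longrightarrow> (0 - w) \<bullet> (x - w) \<le> 0"
    using closed_convex_closest_point[of C 0] unfolding C_def by (metis empty_iff singletonD singletonI vimage_eq)
  \<comment> \<open>The variational inequality at \<open>w + z\<close> and at \<open>w - z\<close>
    gives both signs.\<close>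
  have orth: "w \<bullet> z = 0" if "f z = 0" for z
    using w[of "w + z"] w[of "w - z"] that wC by (simp add: f.add f.diff)
  have "w \<noteq> 0" using wC by auto
  have "f x = ((1 / (w \<bullet> w)) *\<^sub>R w) \<bullet> x" for x
    using orth[of "x - f x *\<^sub>R w"] wC \<open>w \<noteq> 0\<close> by (simp add: f.diff f.scaleR algebra_simps)
  then show thesis by (rule that)
qed

text \<open>The library provides adjoints only on Euclidean spaces; \<open>adjoint\<close> is a \<open>SOME\<close>-term, so its
  defining property has to come from the Riesz representation.\<close>

lemma inner_adjoint:
  fixes K :: "'a::{real_inner, complete_space} \<Rightarrow> 'b::real_inner"
  assumes "bounded_linear K"
  shows "adjoint K y \<bullet> x = y \<bullet> K x"
proof -
  have "\<exists>a. \<forall>x. K x \<bullet> y = x \<bullet> a" for y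
  proof -
    have "bounded_linear (\<lambda>x. K x \<bullet> y)"
      by (intro bounded_linear_compose[OF bounded_linear_inner_left assms])
    from continuous_linear_functional_inner[OF this] show ?thesis by (metis inner_commute)
  qed
  then have "\<exists>f'. \<forall>x y. K x \<bullet> y = x \<bullet> f' y" by metis
  then have "\<forall>x y. K x \<bullet> y = x \<bullet> adjoint K y" unfolding adjoint_def by (rule someI_ex)
  then show ?thesis by (simp add: inner_commute)
qed

text \<open>Testing weak convergence with \<open>l - w\<close>, where \<open>w\<close> is the
  projection of \<open>l\<close> onto \<open>C\<close>, turns the obtuse-angle inequality into
  \<open>(l - w) \<bullet> (l - w) \<le> 0\<close>.\<close>

lemma closed_convex_weakly_sequentially_closed:
  fixes C :: "'a::{real_inner, complete_space} set"
  assumes "closed C" "convex C" "\<And>v. (\<lambda>n. x n \<bullet> v) \<longlonglongrightarrow> l \<bullet> v"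
    and ev: "\<forall>\<^sub>F n in sequentially. x n \<in> C"
  shows "l \<in> C"
proof -
  have "C \<noteq> {}" using eventually_happens'[OF _ ev] by auto
  then obtain w where w: "w \<in> C" "\<And>x. x \<in> C \<Longrightarrow> (l - w) \<bullet> (x - w) \<le> 0"
    using closed_convex_closest_point[OF assms(1,2)] by blast
  have "(\<lambda>n. x n \<bullet> (l - w) - w \<bullet> (l - w)) \<longlonglongrightarrow> l \<bullet> (l - w) - w \<bullet> (l - w)"
    by (intro tendsto_intros assms)
  then have "l \<bullet> (l - w) - w \<bullet> (l - w) \<le> 0"
  proof (rule tendsto_upperbound)
    show "\<forall>\<^sub>F n in sequentially. x n \<bullet> (l - w) - w \<bullet> (l - w) \<le> 0"
      using ev by eventually_elim (metis inner_commute inner_diff_right w(2))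
  qed simp
  then have "(l - w) \<bullet> (l - w) \<le> 0" by (simp add: inner_diff_left)
  then have "l = w" using inner_ge_zero[of "l - w"] inner_eq_zero_iff[of "l - w"] by simp
  with w show ?thesis by simp
qed

text \<open>Uniform boundedness by Baire: the closed sets \<open>S m\<close> cover the space, so one
  of them contains a ball, on which all functionals given by the \<open>x n\<close> share the bound
  \<open>m\<close>.\<close>

lemma weakly_convergent_imp_norm_bounded:
  fixes x :: "nat \<Rightarrow> 'a::{real_inner, complete_space}"
  assumes "\<And>v. convergent (\<lambda>n. x n \<bullet> v)"
  obtains B where "\<And>n. norm (x n) \<le> B"
proof -
  define S where "S m = {v. \<forall>n. \<bar>x n \<bullet> v\<bar> \<le> real m}" for m
  have clS: "closed (S m)" for m
  proof -
    have "S m = (\<Inter>n. {v. \<bar>x n \<bullet> v\<bar> \<le> real m})" by (auto simp: S_def)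
    then show ?thesis by (auto intro!: closed_INT closed_Collect_le continuous_intros)
  qed
  have "v \<in> (\<Union>m. S m)" for v
  proof -
    obtain B where "\<And>n. norm (x n \<bullet> v) \<le> B"
      using convergent_imp_Bseq[OF assms[of v]] unfolding Bseq_def by blast
    then show ?thesis using real_nat_ceiling_ge[of B] unfolding S_def real_norm_def
      by (auto intro: order_trans)
  qed
  then have UN: "\<Union>(range S) = UNIV" by auto
  have "\<exists>m. interior (S m) \<noteq> {}"
  proof (rule ccontr)
    assume "\<not> ?thesis"
    then have "euclidean interior_of \<Union>(range S) = {}"
      using clS by (intro Baire_category_alt disjI1 completely_metrizable_space_euclidean) auto
    then show False by (simp add: UN)
  qed
  then obtain m a where "a \<in> interior (S m)" by blast
  then obtain e where e: "e > 0" "cball a e \<subseteq> S m" using mem_interior_cball by blast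
  have "norm (x n) \<le> 2 * real m / e" for n
  proof (cases "x n = 0")
    case False
    \<comment> \<open>The point of the ball farthest from its centre in the direction of
      \<open>x n\<close>; testing with \<open>b - a\<close> recovers the norm of
      \<open>x n\<close>.\<close>
    define b where "b = a + (e / norm (x n)) *\<^sub>R x n"
    have "a \<in> S m" "b \<in> S m" using e False by (auto simp: b_def dist_norm)
    then have "\<bar>x n \<bullet> a\<bar> \<le> real m" "\<bar>x n \<bullet> b\<bar> \<le> real m" by (auto simp: S_def)
    then have "x n \<bullet> (b - a) \<le> 2 * real m" by (simp add: inner_diff_right)
    moreover have "x n \<bullet> (b - a) = e * norm (x n)"
      using False by (simp add: b_def dot_square_norm power2_eq_square)
    ultimately show ?thesis using e by (simp add: field_simps)
  qed (use e in simp)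
  then show thesis by (rule that)
qed

section \<open>Extended-real functionals: subgradients, sublevel sets, weak lower
  semicontinuity\<close>

lemma proper_not_MInf: "proper J \<Longrightarrow> J v \<noteq> -\<infinity>"
  by (auto simp: proper_def)

lemma subdifferential_imp_finite:
  assumes "proper J" "\<xi> \<in> subdifferential J u"
  obtains a where "J u = ereal a"
proof (cases "J u")
  case PInf
  obtain v where v: "J v < \<infinity>" using assms(1) by (auto simp: proper_def)
  have "J v - J u - ereal (\<xi> \<bullet> (v - u)) \<ge> 0"
    using assms(2) by (auto simp: subdifferential_def)
  with v PInf show thesis by (cases "J v") auto
qed (use that proper_not_MInf[OF assms(1), of u] in auto)

lemma subdifferential_ineq:
  assumes "\<xi> \<in> subdifferential J u" "J u = ereal a" "J v = ereal b"
  shows "a + \<xi> \<bullet> (v - u) \<le> b"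
proof -
  have "J v - J u - ereal (\<xi> \<bullet> (v - u)) \<ge> 0"
    using assms(1) by (auto simp: subdifferential_def)
  then show ?thesis using assms(2,3) by simp
qed

lemma subdifferentialI:
  assumes "proper J" "J u = ereal a" "\<And>v b. J v = ereal b \<Longrightarrow> a + \<xi> \<bullet> (v - u) \<le> b"
  shows "\<xi> \<in> subdifferential J u"
proof -
  have "J v - J u - ereal (\<xi> \<bullet> (v - u)) \<ge> 0" for v
  proof (cases "J v")
    case (real b)
    then show ?thesis using assms(3)[OF real] assms(2) by simp
  qed (use assms(2) proper_not_MInf[OF assms(1)] in auto)
  then show ?thesis by (simp add: subdifferential_def)
qed

lemma lower_semicont_imp_closed_sublevel:
  assumes "lower_semicont J"
  shows "closed {u. J u \<le> c}"
proof -
  have "\<exists>T. open T \<and> u \<in> T \<and> T \<subseteq> {u. c < J u}" if "c < J u" for u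
  proof -
    have "c < Liminf (at u) J" using assms that unfolding lower_semicont_def by (meson less_le_trans)
    then have "\<forall>\<^sub>F v in at u. c < J v" by (rule less_LiminfD)
    then obtain T where "open T" "u \<in> T" "\<And>v. v \<in> T \<Longrightarrow> v \<noteq> u \<Longrightarrow> c < J v"
      unfolding eventually_at_topological by blast
    \<comment> \<open>The filter \<open>at u\<close> ignores \<open>u\<close> itself; the assumption
      \<open>c < J u\<close> supplies that point.\<close>
    then show ?thesis using that by blast
  qed
  then have "open {u. c < J u}" by (subst open_subopen) blast
  moreover have "{u. J u \<le> c} = - {u. c < J u}" by auto
  ultimately show ?thesis by (simp add: closed_def)
qed

lemma convex_ereal_imp_convex_sublevel:
  assumes "convex_ereal J" "proper J"
  shows "convex {u. J u \<le> ereal c}"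
  unfolding convex_alt
proof clarsimp
  fix x y and t :: real
  assume "J x \<le> ereal c" "J y \<le> ereal c" and t: "0 \<le> t" "t \<le> 1"
  then obtain a b where ab: "J x = ereal a" "J y = ereal b" "a \<le> c" "b \<le> c"
    using proper_not_MInf[OF assms(2)] by (cases "J x"; cases "J y") auto
  have "J ((1 - t) *\<^sub>R x + t *\<^sub>R y) \<le> ereal (1 - t) * J x + ereal t * J y"
    using assms(1) t by (auto simp: convex_ereal_def)
  also have "\<dots> = ereal ((1 - t) * a + t * b)" by (simp add: ab)
  also have "\<dots> \<le> ereal c"
    using convex_bound_le[OF ab(3,4), of "1 - t" t] t by simp
  finally show "J ((1 - t) *\<^sub>R x + t *\<^sub>R y) \<le> ereal c" .
qed

text \<open>Sublevel sets are norm closed and convex, hence weakly sequentially closed.\<close>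

lemma weakly_lower_semicont:
  fixes J :: "'a::{real_inner, complete_space} \<Rightarrow> ereal"
  assumes "proper J" "convex_ereal J" "lower_semicont J"
    and "weakly_tendsto x l sequentially" "\<forall>\<^sub>F n in sequentially. J (x n) \<le> ereal c"
  shows "J l \<le> ereal c"
  using closed_convex_weakly_sequentially_closed[of "{u. J u \<le> ereal c}" x l]
    lower_semicont_imp_closed_sublevel convex_ereal_imp_convex_sublevel assms
  by (auto simp: weakly_tendsto_def)

text \<open>An unbounded sublevel set contains a sequence whose \<open>n\<close>-th norm exceeds
  \<open>n\<close>. None of its subsequences can converge weakly, by uniform boundedness.\<close>

lemma weakly_precompact_sublevels_imp_bounded:
  fixes K :: "'a::{real_inner, complete_space} \<Rightarrow> 'b::real_inner"
  assumes "weakly_precompact_sublevels K J"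
  shows "bounded {u. ereal ((norm (K u))\<^sup>2) + J u \<le> ereal c}" (is "bounded ?S")
proof (rule ccontr)
  assume "\<not> bounded ?S"
  then have "\<exists>u. u \<in> ?S \<and> real n < norm u" for n unfolding bounded_iff by (meson not_le)
  then have "\<exists>x. \<forall>n. x n \<in> ?S \<and> real n < norm (x n)" by (intro choice) blast
  then obtain x where x: "\<And>n. x n \<in> ?S" "\<And>n. real n < norm (x n)" by blast
  then have "range x \<subseteq> ?S" by blast
  then obtain l r where r: "strict_mono r" "weakly_tendsto (x \<circ> r) l sequentially"
    using assms unfolding weakly_precompact_sublevels_def by meson
  then have "convergent (\<lambda>n. (x \<circ> r) n \<bullet> v)" for v
    unfolding weakly_tendsto_def convergent_def by blast
  then obtain B where B: "\<And>n. norm ((x \<circ> r) n) \<le> B"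
    using weakly_convergent_imp_norm_bounded[of "x \<circ> r"] by blast
  obtain n where "B < real n" using reals_Archimedean2 by blast
  also have "real n \<le> real (r n)" using seq_suble[OF r(1)] by simp
  also have "\<dots> < norm ((x \<circ> r) n)" using x(2) by simp
  finally show False using B[of n] by simp
qed

section \<open>The augmented Lagrangian iteration: optimality, monotonicity, stability and
  stopping\<close>

locale convex_variational_problem =
  fixes K :: "'a::{real_inner, complete_space} \<Rightarrow> 'b::{real_inner, complete_space}"
    and J :: "'a \<Rightarrow> ereal"
  assumes bounded_linear: "bounded_linear K"
    and proper: "proper J"
    and convex: "convex_ereal J"
begin

sublocale K: bounded_linear K by (rule bounded_linear)

text \<open>For subgradients in the range of the adjoint, the linear term depends on the points only
  through their images under \<open>K\<close>, so estimates reduce to the data space.\<close>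

lemma adjoint_subgradient_ineq:
  assumes "adjoint K q \<in> subdifferential J w" "J w = ereal a" "J v = ereal b"
  shows "a + q \<bullet> (K v - K w) \<le> b"
  using subdifferential_ineq[OF assms] by (simp add: inner_adjoint[OF bounded_linear] K.diff)

lemma adjoint_subgradient_monotone:
  assumes "adjoint K q \<in> subdifferential J w" "adjoint K q' \<in> subdifferential J w'"
  shows "0 \<le> (q - q') \<bullet> (K w - K w')"
proof -
  obtain a a' where a: "J w = ereal a" "J w' = ereal a'"
    using subdifferential_imp_finite[OF proper] assms by metis
  show ?thesis
    using adjoint_subgradient_ineq[OF assms(1) a] adjoint_subgradient_ineq[OF assms(2) a(2,1)]
    by (simp add: algebra_simps)
qed

lemma augmented_lagrangian_run_Suc:
  assumes "augmented_lagrangian_run K J \<tau> y q u p"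
  shows "p (Suc n) = p n - \<tau> (Suc n) *\<^sub>R (K (u (Suc n)) - y)"
proof -
  have "p (Suc n) = p n + \<tau> (Suc n) *\<^sub>R (y - K (u (Suc n)))"
    using assms unfolding augmented_lagrangian_run_def by simp
  then show ?thesis by (simp add: scaleR_right_diff_distrib)
qed

text \<open>First-order optimality along segments: \<open>u n\<close> is compared with the points
  \<open>z\<close> between it and \<open>v\<close>. The squared norm leaves a remainder of second
  order in \<open>t\<close>, which vanishes after division by \<open>t\<close> and the limit
  \<open>t\<close> to 0.\<close>

lemma augmented_lagrangian_subgradient:
  assumes run: "augmented_lagrangian_run K J \<tau> y q u p" and n: "n \<ge> 1"
  shows "adjoint K (p n) \<in> subdifferential J (u n)"
proof -
  define \<phi> where "\<phi> v = ereal (\<tau> n / 2 * (norm (K v - y))\<^sup>2) + J v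
      - ereal (p (n - 1) \<bullet> (K v - y))" for v
  have min: "\<phi> (u n) \<le> \<phi> v" for v
    using run n unfolding augmented_lagrangian_run_def is_arg_min_def \<phi>_def by (meson not_le)
  obtain v0 where "J v0 < \<infinity>" using proper by (auto simp: proper_def)
  then obtain a where a: "J (u n) = ereal a"
    using min[of v0] proper_not_MInf[OF proper] unfolding \<phi>_def
    by (cases "J (u n)"; cases "J v0") auto
  define r where "r = K (u n) - y"
  have pn: "p n = p (n - 1) - \<tau> n *\<^sub>R r"
    using augmented_lagrangian_run_Suc[OF run, of "n - 1"] n by (simp add: r_def)
  show ?thesis
  proof (rule subdifferentialI[OF proper a])
    fix v b assume b: "J v = ereal b"
    define k where "k = K v - K (u n)"
    have "a + p n \<bullet> k \<le> b + t * (\<tau> n / 2 * (norm k)\<^sup>2)" if t: "0 < t" "t \<le> 1" for t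
    proof -
      define z where "z = (1 - t) *\<^sub>R u n + t *\<^sub>R v"
      have "J z \<le> ereal (1 - t) * J (u n) + ereal t * J v"
        using convex t by (simp add: convex_ereal_def z_def)
      also have "\<dots> = ereal ((1 - t) * a + t * b)" by (simp add: a b)
      finally obtain c where c: "J z = ereal c" "c \<le> (1 - t) * a + t * b"
        using proper_not_MInf[OF proper, of z] by (cases "J z") auto
      have Kz: "K z - y = r + t *\<^sub>R k"
        by (simp add: z_def r_def k_def K.add K.scaleR K.diff scaleR_left_diff_distrib scaleR_right_diff_distrib)
      have "\<tau> n / 2 * (norm r)\<^sup>2 + a - p (n - 1) \<bullet> r
          \<le> \<tau> n / 2 * (norm (r + t *\<^sub>R k))\<^sup>2 + c - p (n - 1) \<bullet> (r + t *\<^sub>R k)"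
        using min[of z] unfolding \<phi>_def Kz a c(1) by (simp add: r_def)
      moreover have "(norm (r + t *\<^sub>R k))\<^sup>2 = (norm r)\<^sup>2 + 2 * t * (r \<bullet> k) + t * t * (norm k)\<^sup>2"
        by (simp add: power2_norm_eq_inner algebra_simps inner_commute)
      \<comment> \<open>The derivative of the penalty is exactly the increment of the multiplier
        update, so \<open>p (n - 1)\<close> is replaced by \<open>p n\<close>.\<close>
      moreover have "t * (p n \<bullet> k) = t * (p (n - 1) \<bullet> k) - t * (\<tau> n * (r \<bullet> k))"
        by (simp add: pn inner_diff_left right_diff_distrib)
      ultimately have "0 \<le> t * (b + t * (\<tau> n / 2 * (norm k)\<^sup>2) - (a + p n \<bullet> k))"
        using c(2) by (simp add: algebra_simps)
      then show ?thesis using t by (simp add: zero_le_mult_iff)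
    qed
    then have "\<forall>\<^sub>F t in at_right 0. a + p n \<bullet> k \<le> b + t * (\<tau> n / 2 * (norm k)\<^sup>2)"
      using eventually_at_right_real[of 0 1] by (auto elim!: eventually_mono)
    moreover have "((\<lambda>t. b + t * (\<tau> n / 2 * (norm k)\<^sup>2)) \<longlongrightarrow> b + 0 * (\<tau> n / 2 * (norm k)\<^sup>2)) (at_right 0)"
      by (intro tendsto_intros)
    ultimately have "a + p n \<bullet> k \<le> b"
      using tendsto_lowerbound by fastforce
    then show "a + adjoint K (p n) \<bullet> (v - u n) \<le> b"
      by (simp add: inner_adjoint[OF bounded_linear] K.diff k_def)
  qed
qed

text \<open>The dual increment is a negative multiple of the new residual \<open>r'\<close>, so
  monotonicity of subgradients gives \<open>r' \<bullet> r' \<le> r' \<bullet> r\<close>, and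
  Cauchy-Schwarz compares the norms.\<close>

lemma augmented_lagrangian_residual_antimono:
  assumes run: "augmented_lagrangian_run K J \<tau> y q u p" and \<tau>: "\<And>n. n \<ge> 1 \<Longrightarrow> \<tau> n > 0"
    and "1 \<le> m" "m \<le> n"
  shows "norm (K (u n) - y) \<le> norm (K (u m) - y)"
  using \<open>m \<le> n\<close>
proof (induction n rule: dec_induct)
  case (step n)
  define r r' where "r = K (u n) - y" and "r' = K (u (Suc n)) - y"
  have "p (Suc n) - p n = - (\<tau> (Suc n) *\<^sub>R r')"
    by (simp add: augmented_lagrangian_run_Suc[OF run] r'_def)
  moreover have "0 \<le> (p (Suc n) - p n) \<bullet> (K (u (Suc n)) - K (u n))"
    using step \<open>1 \<le> m\<close>
    by (intro adjoint_subgradient_monotone augmented_lagrangian_subgradient[OF run]) auto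
  moreover have "K (u (Suc n)) - K (u n) = r' - r" by (simp add: r_def r'_def)
  ultimately have "\<tau> (Suc n) * (r' \<bullet> (r' - r)) \<le> 0" by simp
  then have "r' \<bullet> r' \<le> r' \<bullet> r"
    using \<tau>[of "Suc n"] by (simp add: mult_le_0_iff inner_diff_right)
  also have "\<dots> \<le> norm r' * norm r" by (rule norm_cauchy_schwarz)
  finally have "norm r' * norm r' \<le> norm r' * norm r" by (simp add: dot_square_norm power2_eq_square)
  then have "norm r' \<le> norm r" by (cases "r' = 0") auto
  then show ?case using step.IH by (simp add: r_def r'_def)
qed simp

text \<open>Each step is a resolvent step: for the differences \<open>e\<close> of the new dual
  iterates and \<open>k\<close> of the new images, monotonicity gives
  \<open>0 \<le> e \<bullet> k\<close>, so adding a positive multiple of \<open>k\<close> cannot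
  shorten \<open>e\<close>. The sum is the old dual difference plus the data perturbation.\<close>

lemma augmented_lagrangian_dual_nonexpansive:
  assumes run: "augmented_lagrangian_run K J \<tau> y q u p"
    and run': "augmented_lagrangian_run K J \<tau> y' q' u' p'"
    and \<tau>: "\<And>n. n \<ge> 1 \<Longrightarrow> \<tau> n > 0"
  shows "norm (p n - p' n) \<le> norm (q - q') + (\<Sum>k=1..n. \<tau> k) * norm (y - y')"
proof (induction n)
  case 0
  then show ?case using run run' by (simp add: augmented_lagrangian_run_def)
next
  case (Suc n)
  define e k where "e = p (Suc n) - p' (Suc n)" and "k = K (u (Suc n)) - K (u' (Suc n))"
  have \<tau>0: "\<tau> (Suc n) > 0" using \<tau> by simp
  have eq: "e + \<tau> (Suc n) *\<^sub>R k = (p n - p' n) + \<tau> (Suc n) *\<^sub>R (y - y')"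
    by (simp add: augmented_lagrangian_run_Suc[OF run] augmented_lagrangian_run_Suc[OF run']
        e_def k_def scaleR_right_diff_distrib)
  have "0 \<le> e \<bullet> k" unfolding e_def k_def
    by (intro adjoint_subgradient_monotone augmented_lagrangian_subgradient[OF run]
        augmented_lagrangian_subgradient[OF run']) auto
  then have "e \<bullet> e \<le> e \<bullet> (e + \<tau> (Suc n) *\<^sub>R k)" using \<tau>0 by (simp add: inner_add_right)
  also have "\<dots> \<le> norm e * norm (e + \<tau> (Suc n) *\<^sub>R k)" by (rule norm_cauchy_schwarz)
  finally have "norm e * norm e \<le> norm e * norm (e + \<tau> (Suc n) *\<^sub>R k)"
    by (simp add: dot_square_norm power2_eq_square)
  then have "norm e \<le> norm (e + \<tau> (Suc n) *\<^sub>R k)" by (cases "e = 0") auto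
  also have "\<dots> \<le> norm (p n - p' n) + \<tau> (Suc n) * norm (y - y')"
    unfolding eq using norm_triangle_ineq[of "p n - p' n" "\<tau> (Suc n) *\<^sub>R (y - y')"] \<tau>0 by simp
  finally show ?case using Suc by (simp add: e_def algebra_simps)
qed

text \<open>Otherwise the Bregman distances \<open>D n\<close> of \<open>v\<close> to the iterates would drop by at least a fixed
  multiple of \<open>\<tau> n\<close> in each step and become negative.\<close>

lemma morozov_index_exists:
  assumes run: "augmented_lagrangian_run K J \<tau> y q u p" and \<tau>: "\<And>n. n \<ge> 1 \<Longrightarrow> \<tau> n > 0"
    and t: "filterlim (\<lambda>n. \<Sum>k=1..n. \<tau> k) at_top sequentially"
    and v: "J v < \<infinity>" "norm (y - K v) \<le> \<delta>" and "\<delta> > 0" "\<rho> > 1"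
  shows "\<exists>n. 1 \<le> n \<and> norm (K (u n) - y) < \<rho> * \<delta>"
proof (rule ccontr)
  assume "\<not> ?thesis"
  then have large: "\<rho> * \<delta> \<le> norm (K (u n) - y)" if "n \<ge> 1" for n
    using that by (meson not_le)
  obtain b where b: "J v = ereal b"
    using v(1) proper_not_MInf[OF proper, of v] by (cases "J v") auto
  note sub = augmented_lagrangian_subgradient[OF run]
  define j where "j n = real_of_ereal (J (u n))" for n
  have j: "J (u n) = ereal (j n)" if "n \<ge> 1" for n
    using subdifferential_imp_finite[OF proper sub[OF that]] unfolding j_def by (metis real_of_ereal.simps(1))
  define D where "D n = b - j n - p n \<bullet> (K v - K (u n))" for n
  have D0: "0 \<le> D n" if "n \<ge> 1" for n
    using adjoint_subgradient_ineq[OF sub j b, OF that that] by (simp add: D_def)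
  \<comment> \<open>A lower bound for \<open>norm r * (norm r - \<delta>)\<close> while the residual
    stays at least \<open>\<rho> * \<delta>\<close>; it is positive because
    \<open>\<rho> > 1\<close>.\<close>
  define c where "c = \<rho> * \<delta> * (\<rho> * \<delta> - \<delta>)"
  have c0: "c > 0" using \<open>\<delta> > 0\<close> \<open>\<rho> > 1\<close> by (simp add: c_def)
  have step: "D (Suc n) \<le> D n - c * \<tau> (Suc n)" if n: "n \<ge> 1" for n
  proof -
    define r where "r = K (u (Suc n)) - y"
    have pS: "p (Suc n) = p n - \<tau> (Suc n) *\<^sub>R r"
      by (simp add: augmented_lagrangian_run_Suc[OF run] r_def)
    have "j n + p n \<bullet> (K (u (Suc n)) - K (u n)) \<le> j (Suc n)"
      using adjoint_subgradient_ineq[OF sub j j] n by simp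
    then have "D (Suc n) \<le> D n + \<tau> (Suc n) * (r \<bullet> (K v - K (u (Suc n))))"
      unfolding D_def pS by (simp add: algebra_simps)
    moreover have "r \<bullet> (K v - K (u (Suc n))) \<le> - c"
    proof -
      have "r \<bullet> (K v - K (u (Suc n))) = r \<bullet> (K v - y) - norm r * norm r"
        by (simp add: r_def algebra_simps flip: power2_eq_square dot_square_norm)
      also have "r \<bullet> (K v - y) \<le> norm r * norm (K v - y)" by (rule norm_cauchy_schwarz)
      also have "\<dots> \<le> norm r * \<delta>"
        using v(2) by (intro mult_left_mono) (auto simp: norm_minus_commute)
      finally have "r \<bullet> (K v - K (u (Suc n))) \<le> - (norm r * (norm r - \<delta>))"
        by (simp add: algebra_simps)
      moreover have "c \<le> norm r * (norm r - \<delta>)"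
        unfolding c_def using large[of "Suc n"] \<open>\<delta> > 0\<close> \<open>\<rho> > 1\<close>
        by (intro mult_mono) (auto simp: r_def)
      ultimately show ?thesis by simp
    qed
    then have "\<tau> (Suc n) * (r \<bullet> (K v - K (u (Suc n)))) \<le> \<tau> (Suc n) * - c"
      using \<tau>[of "Suc n"] by (intro mult_left_mono) auto
    ultimately show ?thesis by (simp add: mult.commute)
  qed
  \<comment> \<open>Since \<open>u 0\<close> is arbitrary, telescoping starts at \<open>D 1\<close>,
    and the first step size has to be subtracted.\<close>
  have bound: "D n \<le> D 1 - c * ((\<Sum>k=1..n. \<tau> k) - \<tau> 1)" if "n \<ge> 1" for n
    using that
  proof (induction n rule: dec_induct)
    case (step n)
    then show ?case using \<open>\<And>n. 1 \<le> n \<Longrightarrow> D (Suc n) \<le> _\<close>[of n] by (simp add: algebra_simps)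
  qed simp
  have "\<forall>\<^sub>F n in sequentially. D 1 / c + \<tau> 1 < (\<Sum>k=1..n. \<tau> k)"
    using t by (simp add: filterlim_at_top_dense)
  then have "\<forall>\<^sub>F n in sequentially. D 1 / c + \<tau> 1 < (\<Sum>k=1..n. \<tau> k) \<and> n \<ge> 1"
    using eventually_ge_at_top by (rule eventually_conj)
  then obtain n where n: "D 1 / c + \<tau> 1 < (\<Sum>k=1..n. \<tau> k)" "n \<ge> 1"
    using eventually_happens'[OF sequentially_bot] by blast
  then have "D 1 < c * ((\<Sum>k=1..n. \<tau> k) - \<tau> 1)"
    using c0 by (simp add: field_simps)
  then show False using bound[OF n(2)] D0[OF n(2)] by simp
qed

section \<open>Limits along vanishing residuals: dual minimizers, primal minimizers and source
  elements\<close>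

text \<open>The subgradient inequality bounds \<open>J (w k)\<close> from above through
  \<open>J v\<close>, and the conjugate at \<open>q'\<close> bounds it from below. After
  \<open>J (w k)\<close> is eliminated, \<open>q k\<close> is paired only with the fixed
  \<open>K v - g\<close>, up to an error controlled by \<open>R\<close> and the residual.\<close>

lemma weak_limit_minimizes_dual:
  assumes sub: "\<forall>\<^sub>F k in sequentially. adjoint K (q k) \<in> subdifferential J (w k)"
    and R: "\<forall>\<^sub>F k in sequentially. norm (q k) \<le> R"
    and Kw: "(\<lambda>k. K (w k)) \<longlonglongrightarrow> g"
    and weak: "weakly_tendsto q l sequentially"
  shows "is_arg_min (\<lambda>q'. dual_functional K J q' g) (\<lambda>_. True) l"
proof -
  have "dual_functional K J l g \<le> dual_functional K J q' g" for q'
  proof (cases "conjugate J (adjoint K q')")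
    \<comment> \<open>Properness excludes this case: a point of the domain bounds the supremum from
      below by a real number.\<close>
    case MInf
    obtain v0 b0 where "J v0 = ereal b0"
      using proper unfolding proper_def by (metis ereal_cases less_irrefl)
    then have "ereal (adjoint K q' \<bullet> v0 - b0) \<le> conjugate J (adjoint K q')"
      unfolding conjugate_def by (intro SUP_upper2[of v0]) auto
    then show ?thesis using MInf by simp
  next
    case PInf
    then show ?thesis by (simp add: dual_functional_def)
  next
    case (real s)
    have s: "q' \<bullet> K v - b \<le> s" if "J v = ereal b" for v b
    proof -
      have "ereal (adjoint K q' \<bullet> v) - J v \<le> conjugate J (adjoint K q')"
        unfolding conjugate_def by (rule SUP_upper) simp
      then show ?thesis using real that by (simp add: inner_adjoint[OF bounded_linear])
    qed
    have main: "l \<bullet> (K v - g) - b \<le> s - q' \<bullet> g" if b: "J v = ereal b" for v b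
    proof -
      have "\<forall>\<^sub>F k in sequentially. q k \<bullet> (K v - g) - b \<le> R * norm (K (w k) - g) + s - q' \<bullet> K (w k)"
        using sub R
      proof eventually_elim
        case (elim k)
        obtain a where a: "J (w k) = ereal a"
          using subdifferential_imp_finite[OF proper elim(1)] by blast
        have "a + q k \<bullet> (K v - K (w k)) \<le> b"
          by (rule adjoint_subgradient_ineq[OF elim(1) a b])
        moreover have "q k \<bullet> (K (w k) - g) \<le> R * norm (K (w k) - g)"
          using norm_cauchy_schwarz[of "q k" "K (w k) - g"] mult_right_mono[OF elim(2), of "norm (K (w k) - g)"]
          by simp
        ultimately show ?case using s[OF a] by (simp add: inner_diff_right)
      qed
      moreover have "(\<lambda>k. q k \<bullet> (K v - g) - b) \<longlonglongrightarrow> l \<bullet> (K v - g) - b"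
        using weak unfolding weakly_tendsto_def by (intro tendsto_diff tendsto_const) blast
      moreover have "(\<lambda>k. R * norm (K (w k) - g) + s - q' \<bullet> K (w k)) \<longlonglongrightarrow> R * norm (g - g) + s - q' \<bullet> g"
        by (intro tendsto_intros Kw)
      ultimately show ?thesis using tendsto_le[OF sequentially_bot] by fastforce
    qed
    have "conjugate J (adjoint K l) \<le> ereal (s - q' \<bullet> g + l \<bullet> g)"
      unfolding conjugate_def
    proof (rule SUP_least)
      fix v
      show "ereal (adjoint K l \<bullet> v) - J v \<le> ereal (s - q' \<bullet> g + l \<bullet> g)"
      proof (cases "J v")
        case (real b)
        then show ?thesis using main[OF real] by (simp add: inner_adjoint[OF bounded_linear] inner_diff_right)
      qed (use proper_not_MInf[OF proper, of v] in auto)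
    qed
    then show ?thesis unfolding dual_functional_def real
      by (cases "conjugate J (adjoint K l)") auto
  qed
  then show ?thesis unfolding is_arg_min_def by (simp add: not_less)
qed

end

locale regularized_problem = convex_variational_problem K J
  for K :: "'a::{real_inner, complete_space} \<Rightarrow> 'b::{real_inner, complete_space}"
    and J :: "'a \<Rightarrow> ereal" +
  fixes g :: 'b
  assumes lower_semicont: "lower_semicont J"
    and precompact: "weakly_precompact_sublevels K J"
    and attainable: "\<exists>v. J v < \<infinity> \<and> K v = g"
begin

lemma attainable_value:
  obtains v b where "J v = ereal b" "K v = g"
  using attainable proper_not_MInf[OF proper] by (metis ereal_cases less_irrefl)

text \<open>Testing the subgradient inequality at a feasible \<open>v\<close> leaves only the
  pairing of \<open>q\<close> with the residual; bounded dual variables and small residuals thus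
  make \<open>w\<close> almost optimal.\<close>

lemma subgradient_value_bound:
  assumes sub: "adjoint K q \<in> subdifferential J w" and v: "J v = ereal b" "K v = g"
    and R: "norm q \<le> R"
  shows "J w \<le> ereal (b + R * norm (K w - g))"
proof -
  obtain a where a: "J w = ereal a" using subdifferential_imp_finite[OF proper sub] by blast
  have "a + q \<bullet> (g - K w) \<le> b"
    using adjoint_subgradient_ineq[OF sub a v(1)] by (simp add: v(2))
  moreover have "q \<bullet> (K w - g) \<le> R * norm (K w - g)"
    using norm_cauchy_schwarz[of q "K w - g"] mult_right_mono[OF R, of "norm (K w - g)"] by simp
  ultimately show ?thesis by (simp add: a inner_diff_right)
qed

text \<open>Uniformity is the point: \<open>c\<close> depends on \<open>R\<close> and
  \<open>S\<close> but not on \<open>q\<close> and \<open>w\<close>, so a whole family of iterates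
  lies in one sublevel set and the compactness assumption applies.\<close>

lemma subgradient_points_sublevel:
  obtains c where "\<And>q w. adjoint K q \<in> subdifferential J w \<Longrightarrow> norm q \<le> R \<Longrightarrow> norm (K w - g) \<le> S
    \<Longrightarrow> ereal ((norm (K w))\<^sup>2) + J w \<le> ereal c"
proof -
  obtain v b where v: "J v = ereal b" "K v = g" by (rule attainable_value)
  have "ereal ((norm (K w))\<^sup>2) + J w \<le> ereal ((norm g + S)\<^sup>2 + (b + \<bar>R\<bar> * S))"
    if "adjoint K q \<in> subdifferential J w" "norm q \<le> R" "norm (K w - g) \<le> S" for w q
  proof -
    have "norm (K w) \<le> norm g + S" using that(3) norm_triangle_sub[of "K w" g] by simp
    then have "(norm (K w))\<^sup>2 \<le> (norm g + S)\<^sup>2" by (intro power_mono) auto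
    moreover have "J w \<le> ereal (b + \<bar>R\<bar> * S)"
    proof (rule order_trans[OF subgradient_value_bound[OF that(1) v that(2)]])
      have "R * norm (K w - g) \<le> \<bar>R\<bar> * S"
        using that(3) by (intro mult_mono) auto
      then show "ereal (b + R * norm (K w - g)) \<le> ereal (b + \<bar>R\<bar> * S)" by simp
    qed
    ultimately have "ereal ((norm (K w))\<^sup>2) + J w \<le> ereal ((norm g + S)\<^sup>2) + ereal (b + \<bar>R\<bar> * S)"
      by (intro add_mono) simp_all
    then show ?thesis by simp
  qed
  then show thesis by (rule that)
qed

text \<open>Testing weak convergence with \<open>adjoint K y\<close> gives feasibility of
  \<open>l\<close>. For a feasible competitor of value \<open>b\<close> and any
  \<open>e > 0\<close>, \<open>J (w k)\<close> is eventually at most \<open>b + e\<close>, a bound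
  that survives weak limits.\<close>

lemma weak_limit_J_minimizing:
  assumes sub: "\<forall>\<^sub>F k in sequentially. adjoint K (q k) \<in> subdifferential J (w k)"
    and R: "\<forall>\<^sub>F k in sequentially. norm (q k) \<le> R"
    and Kw: "(\<lambda>k. K (w k)) \<longlonglongrightarrow> g"
    and weak: "weakly_tendsto w l sequentially"
  shows "J_minimizing_solution K J g l"
proof -
  have "K l \<bullet> y = g \<bullet> y" for y
  proof (rule LIMSEQ_unique)
    show "(\<lambda>k. K (w k) \<bullet> y) \<longlonglongrightarrow> g \<bullet> y" by (intro tendsto_intros Kw)
    show "(\<lambda>k. K (w k) \<bullet> y) \<longlonglongrightarrow> K l \<bullet> y"
      using weak[unfolded weakly_tendsto_def, rule_format, of "adjoint K y"]
      by (simp add: inner_commute[of _ "adjoint K y"] inner_adjoint[OF bounded_linear] inner_commute[of y])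
  qed
  then have Kl: "K l = g" using vector_eq_rdot by blast
  have "J l \<le> J v" if v: "K v = g" for v
  proof (cases "J v")
    case (real b)
    have lim: "(\<lambda>k. b + R * norm (K (w k) - g)) \<longlonglongrightarrow> b + R * norm (g - g)"
      by (intro tendsto_intros Kw)
    have "J l \<le> ereal (b + e)" if "e > 0" for e
    proof (rule weakly_lower_semicont[OF proper convex lower_semicont weak])
      have "\<forall>\<^sub>F k in sequentially. b + R * norm (K (w k) - g) < b + e"
        using order_tendstoD(2)[OF lim, of "b + e"] that by simp
      then show "\<forall>\<^sub>F k in sequentially. J (w k) \<le> ereal (b + e)"
        using sub R
      proof eventually_elim
        case (elim k)
        have "J (w k) \<le> ereal (b + R * norm (K (w k) - g))"
          by (rule subgradient_value_bound[OF elim(2) real v elim(3)])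
        also have "\<dots> \<le> ereal (b + e)" using elim(1) by simp
        finally show ?case .
      qed
    qed
    then have "J l \<le> ereal b + ereal e" if "e > 0" for e
      using that by simp
    then show ?thesis unfolding real by (rule ereal_le_epsilon2) simp
  qed (use proper_not_MInf[OF proper, of v] in auto)
  then show ?thesis using Kl by (simp add: J_minimizing_solution_def is_arg_min_def not_less)
qed

lemma J_minimizing_solution_le:
  "J_minimizing_solution K J g u \<Longrightarrow> K v = g \<Longrightarrow> J u \<le> J v"
  by (auto simp: J_minimizing_solution_def is_arg_min_def not_less)

text \<open>A subsequence of \<open>w\<close> converges weakly to a \<open>J\<close>-minimizing
  \<open>l\<close>. Since \<open>J l\<close> is at least \<open>J ud\<close>, weak lower
  semicontinuity keeps \<open>J\<close> from dropping noticeably below \<open>J ud\<close> at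
  infinitely many members; their dual variables are approximate source elements.\<close>

lemma source_condition:
  assumes sub: "\<And>k. adjoint K (q k) \<in> subdifferential J (w k)"
    and R: "\<And>k. norm (q k) \<le> R"
    and Kw: "(\<lambda>k. K (w k)) \<longlonglongrightarrow> g"
    and ud: "J_minimizing_solution K J g ud"
  obtains pd where "adjoint K pd \<in> subdifferential J ud"
proof -
  have Kud: "K ud = g" using ud by (simp add: J_minimizing_solution_def is_arg_min_def)
  obtain b where b: "J ud = ereal b"
  proof -
    obtain v c where "J v = ereal c" "K v = g" by (rule attainable_value)
    then show thesis
      using that J_minimizing_solution_le[OF ud, of v] proper_not_MInf[OF proper, of ud] by (cases "J ud") auto
  qed
  have "bounded (range (\<lambda>k. K (w k) - g))"
    by (intro convergent_imp_bounded[of _ "g - g"] tendsto_intros Kw)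
  then obtain S where S: "\<And>k. norm (K (w k) - g) \<le> S" unfolding bounded_iff by blast
  obtain c where "\<And>q w. adjoint K q \<in> subdifferential J w \<Longrightarrow> norm q \<le> R \<Longrightarrow> norm (K w - g) \<le> S
      \<Longrightarrow> ereal ((norm (K w))\<^sup>2) + J w \<le> ereal c"
    using subgradient_points_sublevel[of R S] by blast
  then have "range w \<subseteq> {u. ereal ((norm (K u))\<^sup>2) + J u \<le> ereal c}"
    using sub R S by blast
  then obtain l r where r: "strict_mono r" and weak: "weakly_tendsto (w \<circ> r) l sequentially"
    using precompact unfolding weakly_precompact_sublevels_def by meson
  have Kwr: "(\<lambda>k. K ((w \<circ> r) k)) \<longlonglongrightarrow> g"
    using LIMSEQ_subseq_LIMSEQ[OF Kw r] by (simp add: o_def)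
  have "J_minimizing_solution K J g l"
    using sub R by (intro weak_limit_J_minimizing[of "q \<circ> r" "w \<circ> r" R] Kwr weak) auto
  then have Jl: "ereal b \<le> J l"
    using J_minimizing_solution_le[OF ud] b by (simp add: J_minimizing_solution_def is_arg_min_def)
  \<comment> \<open>Indexing by pairs with finite value \<open>J v = c\<close> makes every
    constraint a closed half-space; the ball supplies the bound for the nested intersection.\<close>
  define A where "A n = cball 0 R \<inter>
      (\<Inter>(v, c)\<in>{(v, c). J v = ereal c}. {p. (K v - g) \<bullet> p \<le> c - b + inverse (real (Suc n))})" for n
  obtain pd where pd: "\<And>n. pd \<in> A n"
  proof (rule nested_closed_convex_Inter_nonempty[of A R])
    show "closed (A n)" for n
      unfolding A_def by (intro closed_Int closed_INT ballI closed_Collect_le continuous_intros)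
        (auto simp: closed_halfspace_le)
    show "convex (A n)" for n
      unfolding A_def by (auto intro!: convex_Int convex_INT convex_halfspace_le)
    show "A n \<subseteq> A m" if "m \<le> n" for m n
    proof -
      have "c - b + inverse (real (Suc n)) \<le> c - b + inverse (real (Suc m))" for c
        using that by (intro add_left_mono le_imp_inverse_le) auto
      then have "{p. (K v - g) \<bullet> p \<le> c - b + inverse (real (Suc n))}
          \<subseteq> {p. (K v - g) \<bullet> p \<le> c - b + inverse (real (Suc m))}" for v c
        by (blast intro: order_trans)
      then show ?thesis unfolding A_def by blast
    qed
    show "norm x \<le> R" if "x \<in> A n" for n x using that by (simp add: A_def)
    show "A n \<noteq> {}" for n
    proof -
      \<comment> \<open>Half of the tolerance covers the drop of \<open>J (w (r k))\<close> below
        \<open>b\<close>, the other half the pairing of \<open>q (r k)\<close> with the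
        residual.\<close>
      define e where "e = inverse (real (Suc n)) / 2"
      have e: "e > 0" by (simp add: e_def)
      have "\<not> (\<forall>\<^sub>F k in sequentially. J ((w \<circ> r) k) \<le> ereal (b - e))"
      proof
        assume "\<forall>\<^sub>F k in sequentially. J ((w \<circ> r) k) \<le> ereal (b - e)"
        from weakly_lower_semicont[OF proper convex lower_semicont weak this] Jl
        have "ereal b \<le> ereal (b - e)" by (rule order_trans[rotated])
        then show False using e by simp
      qed
      then have "\<exists>\<^sub>F k in sequentially. ereal (b - e) < J (w (r k))"
        by (simp add: frequently_def not_less)
      moreover have "\<forall>\<^sub>F k in sequentially. R * norm (K (w (r k)) - g) < e"
      proof -
        have "(\<lambda>k. R * norm (K ((w \<circ> r) k) - g)) \<longlonglongrightarrow> R * norm (g - g)"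
          by (intro tendsto_intros Kwr)
        from order_tendstoD(2)[OF this, of e] e show ?thesis by simp
      qed
      ultimately have "\<exists>\<^sub>F k in sequentially. ereal (b - e) < J (w (r k)) \<and> R * norm (K (w (r k)) - g) < e"
        by (rule frequently_eventually_frequently)
      then obtain k where k: "R * norm (K (w (r k)) - g) < e" "ereal (b - e) < J (w (r k))"
        by (blast dest: frequently_ex)
      obtain a where a: "J (w (r k)) = ereal a"
        using subdifferential_imp_finite[OF proper sub] by metis
      have "(K v - g) \<bullet> q (r k) \<le> c - b + inverse (real (Suc n))" if "J v = ereal c" for v c
      proof -
        have "a + q (r k) \<bullet> (K v - K (w (r k))) \<le> c"
          by (rule adjoint_subgradient_ineq[OF sub a that])
        moreover have "q (r k) \<bullet> (K (w (r k)) - g) \<le> R * norm (K (w (r k)) - g)"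
          using norm_cauchy_schwarz[of "q (r k)" "K (w (r k)) - g"]
            mult_right_mono[OF R[of "r k"], of "norm (K (w (r k)) - g)"] by simp
        moreover have "b - e < a" using k(2) a by simp
        moreover have "inverse (real (Suc n)) = 2 * e" by (simp add: e_def)
        ultimately show ?thesis using k(1) by (simp add: inner_diff_right inner_diff_left inner_commute del: of_nat_Suc)
      qed
      then have "q (r k) \<in> A n" using R unfolding A_def by auto
      then show ?thesis by blast
    qed
  qed blast
  have "adjoint K pd \<in> subdifferential J ud"
  proof (rule subdifferentialI[OF proper b])
    fix v c assume v: "J v = ereal c"
    have "(\<lambda>n. c - b + inverse (real (Suc n))) \<longlonglongrightarrow> c - b + 0"
      by (intro tendsto_intros LIMSEQ_inverse_real_of_nat)
    moreover have "(K v - g) \<bullet> pd \<le> c - b + inverse (real (Suc n))" for n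
      using pd[of n] v unfolding A_def by blast
    ultimately have "(K v - g) \<bullet> pd \<le> c - b + 0" by (intro LIMSEQ_le_const) auto
    then show "b + adjoint K pd \<bullet> (v - ud) \<le> c"
      by (simp add: inner_adjoint[OF bounded_linear] K.diff Kud inner_commute[of _ pd])
  qed
  then show thesis by (rule that)
qed

end

section \<open>The four assertions for the iterates at index \<open>N\<close>\<close>

text \<open>Boundedness is asserted on \<open>{0<..\<delta>\<^sub>0}\<close> because the data may
  move away from \<open>g\<close> as \<delta> grows. The residual estimate is asserted eventually
  because the upper limit controls the stopping index only near zero.\<close>

theorem theorem4p9:
  fixes K :: "'a::{real_inner, complete_space} \<Rightarrow> 'b::{real_inner, complete_space}"
    and J :: "'a \<Rightarrow> ereal"
    and \<tau> :: "nat \<Rightarrow> real"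
    and g :: 'b
    and gd :: "real \<Rightarrow> 'b"
    and p0 :: "real \<Rightarrow> 'b"
    and u :: "real \<Rightarrow> nat \<Rightarrow> 'a"
    and p :: "real \<Rightarrow> nat \<Rightarrow> 'b"
    and \<rho> \<delta>\<^sub>0 :: real
    and N :: nat
  assumes "separable_space (euclidean :: 'a topology)"
    and "separable_space (euclidean :: 'b topology)"
    and "bounded_linear K"
    and "proper J" and "convex_ereal J" and "lower_semicont J"
    and "weakly_precompact_sublevels K J"
    and "\<exists>v. J v < \<infinity> \<and> K v = g"
    and "\<And>n. n \<ge> 1 \<Longrightarrow> \<tau> n > 0"
    and "filterlim (\<lambda>n. \<Sum>k=1..n. \<tau> k) at_top sequentially"
    and "bdd_above (\<tau> ` {1..})"
    and "\<And>\<delta>. \<delta> > 0 \<Longrightarrow> norm (gd \<delta> - g) \<le> \<delta>"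
    and "\<And>\<delta>. \<delta> > 0 \<Longrightarrow> augmented_lagrangian_run K J \<tau> (gd \<delta>) (p0 \<delta>) (u \<delta>) (p \<delta>)"
    and "\<delta>\<^sub>0 > 0" and "bounded (p0 ` {0<..\<delta>\<^sub>0})"
    and "\<rho> > 1"
    and "Limsup (at_right 0) (\<lambda>\<delta>. enat (morozov K \<rho> (u \<delta>) \<delta> (gd \<delta>))) = enat N"
  shows "(bounded ((\<lambda>\<delta>. p \<delta> N) ` {0<..\<delta>\<^sub>0}) \<and>
          (\<forall>q. weak_cluster_point (\<lambda>\<delta>. p \<delta> N) q \<longrightarrow>
            is_arg_min (\<lambda>q'. dual_functional K J q' g) (\<lambda>_. True) q)) \<and>
         (bounded ((\<lambda>\<delta>. u \<delta> N) ` {0<..\<delta>\<^sub>0}) \<and>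
          (\<forall>v. weak_cluster_point (\<lambda>\<delta>. u \<delta> N) v \<longrightarrow> J_minimizing_solution K J g v)) \<and>
         (\<forall>u\<^sub>d. J_minimizing_solution K J g u\<^sub>d \<longrightarrow>
            (\<exists>p\<^sub>d. adjoint K p\<^sub>d \<in> subdifferential J u\<^sub>d)) \<and>
         ((\<forall>\<^sub>F \<delta> in at_right 0. norm (K (u \<delta> N) - g) < (\<rho> + 1) * \<delta>) \<and>
          (\<forall>u\<^sub>d p\<^sub>d. J_minimizing_solution K J g u\<^sub>d \<and> adjoint K p\<^sub>d \<in> subdifferential J u\<^sub>d \<longrightarrow>
            (\<lambda>\<delta>. bregman_sym (adjoint K (p \<delta> N)) (adjoint K p\<^sub>d) (u \<delta> N) u\<^sub>d)
              \<in> O[at_right 0](\<lambda>\<delta>. \<delta>)))"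
proof -
  note run = assms(13) and \<delta>0 = assms(14)
  have \<tau>: "\<And>n. n \<ge> 1 \<Longrightarrow> \<tau> n > 0" by (rule assms(9))
  interpret regularized_problem K J g
    by (intro regularized_problem.intro convex_variational_problem.intro
        regularized_problem_axioms.intro assms(3-8))
  have subgrad: "adjoint K (p \<delta> n) \<in> subdifferential J (u \<delta> n)" if "\<delta> > 0" "n \<ge> 1" for \<delta> n
    by (rule augmented_lagrangian_subgradient[OF run[OF that(1)] that(2)])
  obtain v\<^sub>0 where v0: "J v\<^sub>0 < \<infinity>" "K v\<^sub>0 = g" using attainable by blast
  define \<Gamma> where "\<Gamma> \<delta> = morozov K \<rho> (u \<delta>) \<delta> (gd \<delta>)" for \<delta>
  have \<Gamma>: "1 \<le> \<Gamma> \<delta>" "norm (K (u \<delta> (\<Gamma> \<delta>)) - gd \<delta>) < \<rho> * \<delta>" if "\<delta> > 0" for \<delta>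
  proof -
    have "norm (gd \<delta> - K v\<^sub>0) \<le> \<delta>" using assms(12)[OF that] v0(2) by simp
    \<comment> \<open>The \<open>LEAST\<close> in \<open>morozov\<close> is meaningful once some
      index qualifies; the exact solution \<open>v\<^sub>0\<close> shows that the data are within
      \<delta> of an attainable element.\<close>
    from LeastI_ex[OF morozov_index_exists[OF run[OF that] \<tau> assms(10) v0(1) this that assms(16)]]
    show "1 \<le> \<Gamma> \<delta>" "norm (K (u \<delta> (\<Gamma> \<delta>)) - gd \<delta>) < \<rho> * \<delta>"
      unfolding \<Gamma>_def morozov_def by auto
  qed
  have pos: "\<forall>\<^sub>F \<delta> in at_right 0. (0::real) < \<delta>" by (rule eventually_at_right_less)
  \<comment> \<open>In \<open>enat\<close>, being below \<open>Suc N\<close> means being at most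
    \<open>N\<close>, so the upper limit itself becomes an eventual bound.\<close>
  have "Limsup (at_right 0) (\<lambda>\<delta>. enat (\<Gamma> \<delta>)) < enat (Suc N)"
    using assms(17) by (simp add: \<Gamma>_def)
  from Limsup_lessD[OF this] have \<Gamma>N: "\<forall>\<^sub>F \<delta> in at_right 0. \<Gamma> \<delta> \<le> N" by (simp add: less_Suc_eq_le)
  \<comment> \<open>Stopping indices are at least 1, so a single one that is at most
    \<open>N\<close> excludes \<open>N = 0\<close>, where the primal iterate is arbitrary.\<close>
  have "\<forall>\<^sub>F \<delta> in at_right 0. 0 < \<delta> \<and> \<Gamma> \<delta> \<le> N"
    using pos \<Gamma>N by (rule eventually_conj)
  then obtain \<delta>\<^sub>1 where "0 < \<delta>\<^sub>1" "\<Gamma> \<delta>\<^sub>1 \<le> N"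
    by (auto dest!: eventually_happens)
  then have N1: "1 \<le> N" using \<Gamma>(1)[of \<delta>\<^sub>1] by simp
  have residual: "\<forall>\<^sub>F \<delta> in at_right 0. norm (K (u \<delta> N) - g) < (\<rho> + 1) * \<delta>"
    using pos \<Gamma>N
  proof eventually_elim
    case (elim \<delta>)
    have "norm (K (u \<delta> N) - gd \<delta>) \<le> norm (K (u \<delta> (\<Gamma> \<delta>)) - gd \<delta>)"
      by (rule augmented_lagrangian_residual_antimono[OF run[OF elim(1)] \<tau> \<Gamma>(1)[OF elim(1)] elim(2)])
    also have "\<dots> < \<rho> * \<delta>" by (rule \<Gamma>(2)[OF elim(1)])
    finally show ?case
      using norm_triangle_ineq[of "K (u \<delta> N) - gd \<delta>" "gd \<delta> - g"] assms(12)[OF elim(1)]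
      by (simp add: distrib_right)
  qed
  have Ku_lim: "((\<lambda>\<delta>. K (u \<delta> N)) \<longlongrightarrow> g) (at_right 0)"
  proof (rule LIM_zero_cancel, rule Lim_null_comparison)
    show "\<forall>\<^sub>F \<delta> in at_right 0. norm (K (u \<delta> N) - g) \<le> (\<rho> + 1) * \<delta>"
      using residual by eventually_elim simp
    have "((\<lambda>\<delta>. (\<rho> + 1) * \<delta>) \<longlongrightarrow> (\<rho> + 1) * 0) (at_right 0)" by (intro tendsto_intros)
    then show "((\<lambda>\<delta>. (\<rho> + 1) * \<delta>) \<longlongrightarrow> 0) (at_right 0)" by simp
  qed
  \<comment> \<open>Every run is compared with the fixed reference run at
    \<open>\<delta>\<^sub>0\<close>. The index is general because both \<open>N\<close> and
    \<open>N - 1\<close> enter below.\<close>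
  have p_bdd: "\<exists>R. \<forall>\<delta>\<in>{0<..\<delta>\<^sub>0}. norm (p \<delta> n) \<le> R" for n
  proof -
    from assms(15) obtain B where B: "\<And>\<delta>. \<delta> \<in> {0<..\<delta>\<^sub>0} \<Longrightarrow> norm (p0 \<delta>) \<le> B"
      unfolding bounded_iff by blast
    have "norm (p \<delta> n) \<le> norm (p \<delta>\<^sub>0 n) + (2 * B + (\<Sum>k=1..n. \<tau> k) * (2 * \<delta>\<^sub>0))" if "\<delta> \<in> {0<..\<delta>\<^sub>0}" for \<delta>
    proof -
      have "\<delta> > 0" using that by simp
      have "norm (p \<delta> n - p \<delta>\<^sub>0 n) \<le> norm (p0 \<delta> - p0 \<delta>\<^sub>0) + (\<Sum>k=1..n. \<tau> k) * norm (gd \<delta> - gd \<delta>\<^sub>0)"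
        by (rule augmented_lagrangian_dual_nonexpansive[OF run[OF \<open>\<delta> > 0\<close>] run[OF \<delta>0] \<tau>])
      moreover have "norm (p0 \<delta> - p0 \<delta>\<^sub>0) \<le> 2 * B"
        using norm_triangle_ineq4[of "p0 \<delta>" "p0 \<delta>\<^sub>0"] B[OF that] B[of \<delta>\<^sub>0] \<delta>0 by simp
      moreover have "norm (gd \<delta> - gd \<delta>\<^sub>0) \<le> 2 * \<delta>\<^sub>0"
        using norm_triangle_ineq4[of "gd \<delta> - g" "gd \<delta>\<^sub>0 - g"] assms(12)[OF \<open>\<delta> > 0\<close>] assms(12)[OF \<delta>0] that
        by simp
      then have "(\<Sum>k=1..n. \<tau> k) * norm (gd \<delta> - gd \<delta>\<^sub>0) \<le> (\<Sum>k=1..n. \<tau> k) * (2 * \<delta>\<^sub>0)"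
        using \<tau> by (intro mult_left_mono sum_nonneg) (auto simp: less_imp_le)
      ultimately show ?thesis using norm_triangle_sub[of "p \<delta> n" "p \<delta>\<^sub>0 n"] by linarith
    qed
    then show ?thesis by blast
  qed
  obtain R where R: "\<And>\<delta>. \<delta> \<in> {0<..\<delta>\<^sub>0} \<Longrightarrow> norm (p \<delta> N) \<le> R" using p_bdd[of N] by blast
  obtain R' where R': "\<And>\<delta>. \<delta> \<in> {0<..\<delta>\<^sub>0} \<Longrightarrow> norm (p \<delta> (N - 1)) \<le> R'" using p_bdd[of "N - 1"] by blast
  have cluster: "\<forall>\<^sub>F k in sequentially. adjoint K (p (d k) N) \<in> subdifferential J (u (d k) N)"
    "\<forall>\<^sub>F k in sequentially. norm (p (d k) N) \<le> R"
    "(\<lambda>k. K (u (d k) N)) \<longlonglongrightarrow> g"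
    if d: "filterlim d (at_right 0) sequentially" for d :: "nat \<Rightarrow> real"
  proof -
    have "\<forall>\<^sub>F \<delta> in at_right 0. \<delta> \<in> {0<..<\<delta>\<^sub>0}" by (rule eventually_at_right_real[OF \<delta>0])
    from eventually_compose_filterlim[OF this d]
    have ev: "\<forall>\<^sub>F k in sequentially. d k \<in> {0<..<\<delta>\<^sub>0}" .
    show "\<forall>\<^sub>F k in sequentially. adjoint K (p (d k) N) \<in> subdifferential J (u (d k) N)"
      using ev by eventually_elim (rule subgrad, use N1 in auto)
    show "\<forall>\<^sub>F k in sequentially. norm (p (d k) N) \<le> R"
      using ev by eventually_elim (rule R, auto)
    show "(\<lambda>k. K (u (d k) N)) \<longlonglongrightarrow> g" by (rule filterlim_compose[OF Ku_lim d])
  qed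
  have "bounded ((\<lambda>\<delta>. p \<delta> N) ` {0<..\<delta>\<^sub>0})" unfolding bounded_iff using R by blast
  moreover have "is_arg_min (\<lambda>q'. dual_functional K J q' g) (\<lambda>_. True) q"
    if "weak_cluster_point (\<lambda>\<delta>. p \<delta> N) q" for q
  proof -
    from that obtain d where d: "filterlim d (at_right 0) sequentially"
      and weak: "weakly_tendsto (\<lambda>k. p (d k) N) q sequentially"
      unfolding weak_cluster_point_def by blast
    show ?thesis by (rule weak_limit_minimizes_dual[OF cluster[OF d] weak])
  qed
  moreover have "bounded ((\<lambda>\<delta>. u \<delta> N) ` {0<..\<delta>\<^sub>0})"
  proof -
    \<comment> \<open>Away from zero the stopping index may exceed \<open>N\<close>, so the residual
      is bounded through the dual update instead: it is a difference of two bounded dual iterates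
      divided by \<open>\<tau> N\<close>.\<close>
    define S where "S = \<delta>\<^sub>0 + (R + R') / \<tau> N"
    have S: "norm (K (u \<delta> N) - g) \<le> S" if "\<delta> \<in> {0<..\<delta>\<^sub>0}" for \<delta>
    proof -
      have "\<delta> > 0" using that by simp
      have "p \<delta> N = p \<delta> (N - 1) - \<tau> N *\<^sub>R (K (u \<delta> N) - gd \<delta>)"
        using augmented_lagrangian_run_Suc[OF run[OF \<open>\<delta> > 0\<close>], of "N - 1"] N1 by simp
      then have "\<tau> N *\<^sub>R (K (u \<delta> N) - gd \<delta>) = p \<delta> (N - 1) - p \<delta> N" by simp
      then have "\<tau> N * norm (K (u \<delta> N) - gd \<delta>) = norm (p \<delta> (N - 1) - p \<delta> N)"
        using \<tau>[OF N1] by (metis norm_scaleR abs_of_pos)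
      also have "\<dots> \<le> R + R'"
        using norm_triangle_ineq4[of "p \<delta> (N - 1)" "p \<delta> N"] R[OF that] R'[OF that] by simp
      finally have "norm (K (u \<delta> N) - gd \<delta>) \<le> (R + R') / \<tau> N"
        using \<tau>[OF N1] by (simp add: field_simps)
      then show ?thesis
        using norm_triangle_ineq[of "K (u \<delta> N) - gd \<delta>" "gd \<delta> - g"] assms(12)[OF \<open>\<delta> > 0\<close>] that
        unfolding S_def by simp
    qed
    obtain c where "\<And>q w. adjoint K q \<in> subdifferential J w \<Longrightarrow> norm q \<le> R \<Longrightarrow> norm (K w - g) \<le> S
        \<Longrightarrow> ereal ((norm (K w))\<^sup>2) + J w \<le> ereal c"
      using subgradient_points_sublevel[of R S] by blast
    then have "ereal ((norm (K (u \<delta> N)))\<^sup>2) + J (u \<delta> N) \<le> ereal c" if "\<delta> \<in> {0<..\<delta>\<^sub>0}" for \<delta>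
      using subgrad[of \<delta> N] N1 R[OF that] S[OF that] that by simp
    then have "(\<lambda>\<delta>. u \<delta> N) ` {0<..\<delta>\<^sub>0} \<subseteq> {w. ereal ((norm (K w))\<^sup>2) + J w \<le> ereal c}"
      by auto
    then show ?thesis
      using weakly_precompact_sublevels_imp_bounded[OF precompact] by (rule bounded_subset[rotated])
  qed
  moreover have "J_minimizing_solution K J g v" if "weak_cluster_point (\<lambda>\<delta>. u \<delta> N) v" for v
  proof -
    from that obtain d where d: "filterlim d (at_right 0) sequentially"
      and weak: "weakly_tendsto (\<lambda>k. u (d k) N) v sequentially"
      unfolding weak_cluster_point_def by blast
    show ?thesis by (rule weak_limit_J_minimizing[OF cluster[OF d] weak])
  qed
  moreover have "\<exists>p\<^sub>d. adjoint K p\<^sub>d \<in> subdifferential J u\<^sub>d" if ud: "J_minimizing_solution K J g u\<^sub>d" for u\<^sub>d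
  proof -
    \<comment> \<open>A null sequence inside the interval, so that the bounds hold for every
      \<open>k\<close>, as \<open>source_condition\<close> requires.\<close>
    define d where "d k = \<delta>\<^sub>0 * inverse (real (Suc k))" for k
    have d: "d k \<in> {0<..\<delta>\<^sub>0}" for k
      using \<delta>0 by (simp add: d_def field_simps)
    have "(\<lambda>k. \<delta>\<^sub>0 * inverse (real (Suc k))) \<longlonglongrightarrow> \<delta>\<^sub>0 * 0"
      by (intro tendsto_intros LIMSEQ_inverse_real_of_nat)
    then have "d \<longlonglongrightarrow> 0" unfolding d_def by simp
    then have lim: "filterlim d (at_right 0) sequentially"
      using d by (simp add: filterlim_at eventually_sequentially less_imp_neq[symmetric])
    obtain p\<^sub>d where "adjoint K p\<^sub>d \<in> subdifferential J u\<^sub>d"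
    proof (rule source_condition[OF _ _ cluster(3)[OF lim] ud])
      show "adjoint K (p (d k) N) \<in> subdifferential J (u (d k) N)" for k
        using subgrad[of "d k" N] d[of k] N1 by simp
      show "norm (p (d k) N) \<le> R" for k using R d by blast
    qed
    then show ?thesis by blast
  qed
  moreover have "(\<lambda>\<delta>. bregman_sym (adjoint K (p \<delta> N)) (adjoint K p\<^sub>d) (u \<delta> N) u\<^sub>d) \<in> O[at_right 0](\<lambda>\<delta>. \<delta>)"
    if ud: "J_minimizing_solution K J g u\<^sub>d" for u\<^sub>d p\<^sub>d
  proof (rule bigoI)
    have Kud: "K u\<^sub>d = g" using ud by (simp add: J_minimizing_solution_def is_arg_min_def)
    have "\<forall>\<^sub>F \<delta> in at_right 0. \<delta> \<in> {0<..<\<delta>\<^sub>0}" by (rule eventually_at_right_real[OF \<delta>0])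
    then show "\<forall>\<^sub>F \<delta> in at_right 0.
        norm (bregman_sym (adjoint K (p \<delta> N)) (adjoint K p\<^sub>d) (u \<delta> N) u\<^sub>d)
          \<le> ((R + norm p\<^sub>d) * (\<rho> + 1)) * norm \<delta>"
      using residual
    proof eventually_elim
      case (elim \<delta>)
      \<comment> \<open>The adjoint turns the distance into the pairing of a bounded dual difference
        with a residual of order \<delta>.\<close>
      have "bregman_sym (adjoint K (p \<delta> N)) (adjoint K p\<^sub>d) (u \<delta> N) u\<^sub>d = (p \<delta> N - p\<^sub>d) \<bullet> (K (u \<delta> N) - g)"
        by (simp add: bregman_sym_def inner_diff_left inner_adjoint[OF bounded_linear] K.diff Kud)
      also have "norm \<dots> \<le> norm (p \<delta> N - p\<^sub>d) * norm (K (u \<delta> N) - g)"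
        by (simp add: Cauchy_Schwarz_ineq2)
      also have "\<dots> \<le> (R + norm p\<^sub>d) * ((\<rho> + 1) * \<delta>)"
      proof (rule mult_mono)
        have *: "norm (p \<delta> N) \<le> R" using R elim(1) by simp
        then show "norm (p \<delta> N - p\<^sub>d) \<le> R + norm p\<^sub>d" using norm_triangle_ineq4[of "p \<delta> N" p\<^sub>d] by simp
        show "0 \<le> R + norm p\<^sub>d" using * norm_ge_zero[of "p \<delta> N"] norm_ge_zero[of p\<^sub>d] by linarith
      qed (use elim(2) in auto)
      finally show ?case using elim(1) by simp
    qed
  qed
  ultimately show ?thesis using residual by blast
qed

end
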